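(* Let $(\mathfrak g,\{J_1,J_2,J_3\})$ be a $4n$-dimensional hypercomplex Lie algebra with center $\mathfrak z$ and commutator ideal $\mathfrak g^1=[\mathfrak g,\mathfrak g]$, and assume that $(\alpha,\beta,\gamma)$ is a cyclic permutation of $(1,2,3)$ such that $J_\alpha\mathfrak g^1\subset\mathfrak z$ and $J_\beta\mathfrak g^1\subset\mathfrak z$. Then: (1) the curvature tensor of the Obata connection $\nabla$ is given by $R(X,Y)=-\operatorname{ad}_{[X,Y]}$ for all $X,Y\in\mathfrak g$; hence $(\mathfrak g,\{J_\alpha\})$ is non-flat (i.e. $R\neq0$) if and only if $\mathfrak g$ is $3$-step nilpotent; (2) the holonomy algebra $\mathfrak{hol}(\nabla)$ of the Obata connection $\nabla$ on $G$ is an abelian subalgebra of $\mathfrak{sl}(n,\mathbb H)$, where $G$ is the connected and simply connected Lie group with Lie algebra $\mathfrak g$, endowed with the left-invariant hypercomplex structure induced by $\{J_\alpha\}$. Moreover, $A\cdot B=0$ (composition) for all $A,B\in\mathfrak{hol}(\nabla)$; therefore $\mathfrak{hol}(\nabla)$ is a commutative associative algebra with trivial product.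
   Context: Lie algebras are real and finite-dimensional; $\mathfrak g$ is not assumed nilpotent a priori. A hypercomplex Lie algebra is a Lie algebra $\mathfrak g$ with endomorphisms $J_1,J_2,J_3$ such that $J_\alpha^2=-I$, $J_1J_2=-J_2J_1=J_3$, and $[X,Y]+J_\alpha([J_\alpha X,Y]+[X,J_\alpha Y])-[J_\alpha X,J_\alpha Y]=0$ for all $X,Y\in\mathfrak g$, $\alpha=1,2,3$. A Lie algebra is $k$-step nilpotent if $k$ is the smallest integer with $\mathfrak g^k=0$, where $\mathfrak g^0=\mathfrak g$, $\mathfrak g^k=[\mathfrak g,\mathfrak g^{k-1}]$. The Obata connection is $$\nabla_XY=\tfrac12\big([X,Y]+J_1[J_1X,Y]-J_2[X,J_2Y]+J_3[J_1X,J_2Y]\big),\quad X,Y\in\mathfrak g,$$ the unique torsion-free left-invariant connection commuting with all $J_\alpha$; $R(X,Y)=[\nabla_X,\nabla_Y]-\nabla_{[X,Y]}$. The holonomy algebra $\mathfrak{hol}(\nabla)$ (based at the identity of $G$) is the smallest Lie subalgebra of $\mathfrak{gl}(\mathfrak g)$ containing all $R(X,Y)$ and closed under commutators with all $\nabla_X$, $X\in\mathfrak g$. $\mathfrak{gl}(n,\mathbb H)$ denotes the algebra of real endomorphisms of $\mathfrak g\cong\mathbb H^n$ commuting with $J_1,J_2,J_3$, and $\mathfrak{sl}(n,\mathbb H)$ is its commutator subalgebra $[\mathfrak{gl}(n,\mathbb H),\mathfrak{gl}(n,\mathbb H)]$ (equivalently, its elements with zero real trace). *)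

theory Defs
  imports "HOL-Analysis.Analysis"
begin

section \<open>Real Lie algebras\<close>

text \<open>The underlying vector space is a whole type.
  Finite-dimensionality is required explicitly, since \<^const>\<open>dim\<close> is 0 on
  infinite-dimensional spaces.\<close>

locale lie_algebra =
  fixes br :: "'a::real_vector \<Rightarrow> 'a \<Rightarrow> 'a"
  assumes finite_dimensional: "\<exists>B. finite B \<and> span B = (UNIV :: 'a set)"
    and bilinear_br: "bilinear br"
    and alternating: "br X X = 0"
    and jacobi: "br X (br Y Z) + br Y (br Z X) + br Z (br X Y) = 0"

definition ad :: "('a::real_vector \<Rightarrow> 'a \<Rightarrow> 'a) \<Rightarrow> 'a \<Rightarrow> 'a \<Rightarrow> 'a" where
  "ad br X = (\<lambda>Y. br X Y)"

definition center :: "('a::real_vector \<Rightarrow> 'a \<Rightarrow> 'a) \<Rightarrow> 'a set" where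
  "center br = {Z. \<forall>X. br X Z = 0}"

definition bracket_span :: "('a::real_vector \<Rightarrow> 'a \<Rightarrow> 'a) \<Rightarrow> 'a set \<Rightarrow> 'a set \<Rightarrow> 'a set" where
  "bracket_span br A B = span {br X Y | X Y. X \<in> A \<and> Y \<in> B}"

definition commutator_ideal :: "('a::real_vector \<Rightarrow> 'a \<Rightarrow> 'a) \<Rightarrow> 'a set" where
  "commutator_ideal br = bracket_span br UNIV UNIV"

text \<open>Indexed so that the whole algebra is the term with index 0 and
  \<^const>\<open>commutator_ideal\<close> the one with index 1.\<close>

primrec lower_central :: "('a::real_vector \<Rightarrow> 'a \<Rightarrow> 'a) \<Rightarrow> nat \<Rightarrow> 'a set" where
  "lower_central br 0 = UNIV"
| "lower_central br (Suc k) = bracket_span br UNIV (lower_central br k)"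

definition step_nilpotent :: "('a::real_vector \<Rightarrow> 'a \<Rightarrow> 'a) \<Rightarrow> nat \<Rightarrow> bool" where
  "step_nilpotent br k \<longleftrightarrow>
     lower_central br k = {0} \<and> (\<forall>j<k. lower_central br j \<noteq> {0})"


section \<open>Hypercomplex Lie algebras\<close>

text \<open>The triple of complex structures is a family \<open>J\<close>, of which only the
  indices 1, 2, 3 are ever used.\<close>

locale hypercomplex_lie_algebra = lie_algebra br
  for br :: "'a::real_vector \<Rightarrow> 'a \<Rightarrow> 'a" +
  fixes J :: "nat \<Rightarrow> 'a \<Rightarrow> 'a"
  assumes linear_J: "\<alpha> \<in> {1,2,3} \<Longrightarrow> linear (J \<alpha>)"
    and J_square: "\<alpha> \<in> {1,2,3} \<Longrightarrow> J \<alpha> (J \<alpha> X) = - X"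
    and J1_J2: "J 1 (J 2 X) = J 3 X"
    and J2_J1: "J 2 (J 1 X) = - J 3 X"
    and integrable: "\<alpha> \<in> {1,2,3} \<Longrightarrow>
      br X Y + J \<alpha> (br (J \<alpha> X) Y + br X (J \<alpha> Y)) - br (J \<alpha> X) (J \<alpha> Y) = 0"

definition obata ::
  "('a::real_vector \<Rightarrow> 'a \<Rightarrow> 'a) \<Rightarrow> (nat \<Rightarrow> 'a \<Rightarrow> 'a) \<Rightarrow> 'a \<Rightarrow> 'a \<Rightarrow> 'a" where
  "obata br J X = (\<lambda>Y. (1/2) *\<^sub>R
     (br X Y + J 1 (br (J 1 X) Y) - J 2 (br X (J 2 Y)) + J 3 (br (J 1 X) (J 2 Y))))"


section \<open>Algebras of endomorphisms\<close>

text \<open>Endomorphisms are plain functions that are required to be linear. The function type has no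
  \<^class>\<open>real_vector\<close> instance, so spans of sets of endomorphisms are written
  with \<^const>\<open>hull\<close>.\<close>

definition commutator :: "('a::real_vector \<Rightarrow> 'a) \<Rightarrow> ('a \<Rightarrow> 'a) \<Rightarrow> 'a \<Rightarrow> 'a" where
  "commutator A B = (\<lambda>X. A (B X) - B (A X))"

definition endo_subspace :: "('a::real_vector \<Rightarrow> 'a) set \<Rightarrow> bool" where
  "endo_subspace S \<longleftrightarrow>
     (\<forall>A\<in>S. linear A) \<and> (\<lambda>X. 0) \<in> S \<and>
     (\<forall>A\<in>S. \<forall>B\<in>S. (\<lambda>X. A X + B X) \<in> S) \<and>
     (\<forall>c. \<forall>A\<in>S. (\<lambda>X. c *\<^sub>R A X) \<in> S)"

definition lie_subalgebra_gl :: "('a::real_vector \<Rightarrow> 'a) set \<Rightarrow> bool" where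
  "lie_subalgebra_gl S \<longleftrightarrow>
     endo_subspace S \<and> (\<forall>A\<in>S. \<forall>B\<in>S. commutator A B \<in> S)"

definition abelian_lie_subalgebra_gl :: "('a::real_vector \<Rightarrow> 'a) set \<Rightarrow> bool" where
  "abelian_lie_subalgebra_gl S \<longleftrightarrow>
     lie_subalgebra_gl S \<and> (\<forall>A\<in>S. \<forall>B\<in>S. commutator A B = (\<lambda>X. 0))"

definition commutative_subalgebra_End :: "('a::real_vector \<Rightarrow> 'a) set \<Rightarrow> bool" where
  "commutative_subalgebra_End S \<longleftrightarrow>
     endo_subspace S \<and> (\<forall>A\<in>S. \<forall>B\<in>S. A \<circ> B \<in> S \<and> A \<circ> B = B \<circ> A)"

definition gl_H :: "(nat \<Rightarrow> 'a::real_vector \<Rightarrow> 'a) \<Rightarrow> ('a \<Rightarrow> 'a) set" where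
  "gl_H J = {A. linear A \<and> (\<forall>\<alpha>\<in>{1,2,3}. A \<circ> J \<alpha> = J \<alpha> \<circ> A)}"

definition sl_H :: "(nat \<Rightarrow> 'a::real_vector \<Rightarrow> 'a) \<Rightarrow> ('a \<Rightarrow> 'a) set" where
  "sl_H J = endo_subspace hull {commutator A B | A B. A \<in> gl_H J \<and> B \<in> gl_H J}"


section \<open>Curvature and holonomy of the Obata connection\<close>

definition curvature ::
  "('a::real_vector \<Rightarrow> 'a \<Rightarrow> 'a) \<Rightarrow> (nat \<Rightarrow> 'a \<Rightarrow> 'a) \<Rightarrow> 'a \<Rightarrow> 'a \<Rightarrow> 'a \<Rightarrow> 'a" where
  "curvature br J X Y =
     (\<lambda>Z. commutator (obata br J X) (obata br J Y) Z - obata br J (br X Y) Z)"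

definition flat ::
  "('a::real_vector \<Rightarrow> 'a \<Rightarrow> 'a) \<Rightarrow> (nat \<Rightarrow> 'a \<Rightarrow> 'a) \<Rightarrow> bool" where
  "flat br J \<longleftrightarrow> (\<forall>X Y Z. curvature br J X Y Z = 0)"

text \<open>The Lie algebra of the holonomy group at the identity of the simply connected group,
  for the left-invariant connection \<^const>\<open>obata\<close>, in its algebraic description.\<close>

definition hol ::
  "('a::real_vector \<Rightarrow> 'a \<Rightarrow> 'a) \<Rightarrow> (nat \<Rightarrow> 'a \<Rightarrow> 'a) \<Rightarrow> ('a \<Rightarrow> 'a) set" where
  "hol br J =
     (\<lambda>S. lie_subalgebra_gl S \<and> (\<forall>X. \<forall>A\<in>S. commutator (obata br J X) A \<in> S))
       hull {curvature br J X Y | X Y. True}"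

end

theory Submission
  imports Defs
begin

text \<open>
  Write \<open>D\<close> for the Obata connection and \<open>g\<^sup>1\<close> for the commutator ideal. The whole
  theorem rests on the vanishing of all products \<open>D\<^sub>X \<circ> D\<^sub>Y\<close>.

  If \<open>W \<in> g\<^sup>1\<close>, two of the vectors \<open>J\<^sub>1 W\<close>, \<open>J\<^sub>2 W\<close>, \<open>J\<^sub>3 W\<close> are central, and for each of
  these two complex structures integrability reduces to the statement that \<open>ad W\<close> commutes with
  it. Hence \<open>ad W\<close> is quaternionic linear, and the Obata formula collapses to \<open>D\<^sub>W = ad W\<close>
  (lemma \<open>obata_commutator_ideal\<close>). As \<open>D\<close> is torsion-free, \<open>D\<^sub>X W = D\<^sub>W X + [X, W] = 0\<close>; as
  \<open>D\<^sub>X\<close> commutes with every \<open>J\<^sub>a\<close>, it kills the quaternionic span of \<open>g\<^sup>1\<close>. By its very formula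
  \<open>D\<close> takes its values in that span, so \<open>D\<^sub>X \<circ> D\<^sub>Y = 0\<close> (lemma \<open>obata_comp_obata\<close>).

  It follows that \<open>R(X,Y) = - D\<^bsub>[X,Y]\<^esub> = - ad [X,Y]\<close>. Flatness therefore means \<open>g\<^sup>2 = 0\<close>, whereas
  \<open>g\<^sup>3 = 0\<close> always holds: for \<open>W \<in> g\<^sup>1\<close>, quaternionic linearity of \<open>ad W\<close> gives
  \<open>[W, Y] = - J\<^sub>\<alpha> [W, J\<^sub>\<alpha> Y]\<close>, an element of the central subspace \<open>J\<^sub>\<alpha> g\<^sup>1\<close>.
  The operators \<open>ad W = D\<^sub>W\<close> with \<open>W \<in> g\<^sup>1\<close> form a space with zero products that is
  annihilated by bracketing with any \<open>D\<^sub>X\<close> and spanned by the curvature operators, so it is the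
  holonomy algebra.

  For the inclusion in \<open>sl(n,H)\<close> no trace is computed: a quaternionic linear \<open>A\<close> with \<open>A\<^sup>2 = 0\<close>
  has a quaternionic linear \<open>Q\<close> with \<open>A Q A = A\<close>, and then \<open>A = [A Q, A]\<close> is a commutator
  (lemma \<open>square_zero_in_sl_H\<close>).
\<close>

(* The index 1 of the first complex structure has to survive simplification. *)
declare One_nat_def [simp del]


section \<open>Quaternionic linear algebra\<close>

context hypercomplex_lie_algebra
begin

lemma quaternion_relations:
  shows "J 1 (J 1 X) = - X" "J 2 (J 2 X) = - X" "J 3 (J 3 X) = - X"
    and "J 1 (J 2 X) = J 3 X" "J 2 (J 1 X) = - J 3 X"
    and "J 2 (J 3 X) = J 1 X" "J 3 (J 2 X) = - J 1 X"
    and "J 3 (J 1 X) = J 2 X" "J 1 (J 3 X) = - J 2 X"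
proof -
  have neg: "J a (- Y) = - J a Y" if "a \<in> {1,2,3}" for a Y
    using linear_neg[OF linear_J[OF that]] .
  show sq: "J 1 (J 1 X) = - X" "J 2 (J 2 X) = - X" "J 3 (J 3 X) = - X" for X
    using J_square by auto
  show "J 1 (J 2 X) = J 3 X" "J 2 (J 1 X) = - J 3 X"
    by (rule J1_J2 J2_J1)+
  show "J 1 (J 3 X) = - J 2 X"
    by (metis J1_J2 sq(1))
  show "J 3 (J 2 X) = - J 1 X"
    by (metis J1_J2 sq(2) neg insertCI)
  show "J 2 (J 3 X) = J 1 X"
    by (metis J2_J1 J1_J2 sq(2) minus_minus)
  show "J 3 (J 1 X) = J 2 X"
    by (metis J2_J1 J1_J2 sq(1) minus_minus)
qed

lemmas J_linear_simps =
  linear_add[OF linear_J] linear_diff[OF linear_J] linear_neg[OF linear_J]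
  linear_scale[OF linear_J] linear_0[OF linear_J]

lemmas br_linear_simps =
  bilinear_ladd[OF bilinear_br] bilinear_radd[OF bilinear_br]
  bilinear_lsub[OF bilinear_br] bilinear_rsub[OF bilinear_br]
  bilinear_lneg[OF bilinear_br] bilinear_rneg[OF bilinear_br]
  bilinear_lmul[OF bilinear_br] bilinear_rmul[OF bilinear_br]
  bilinear_lzero[OF bilinear_br] bilinear_rzero[OF bilinear_br]

lemma br_skew: "br X Y = - br Y X"
proof -
  have "br (X + Y) (X + Y) = 0" by (rule alternating)
  then have "br X Y + br Y X = 0"
    by (simp only: br_linear_simps alternating[of X] alternating[of Y] add_0_left add_0_right
        add.commute)
  then show ?thesis by (simp add: eq_neg_iff_add_eq_0)
qed

lemma gl_H_iff:
  "A \<in> gl_H J \<longleftrightarrow> linear A \<and> (\<forall>a\<in>{1,2,3}. \<forall>X. A (J a X) = J a (A X))"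
  by (auto simp: gl_H_def fun_eq_iff)

lemma comp_in_gl_H: "A \<in> gl_H J \<Longrightarrow> B \<in> gl_H J \<Longrightarrow> A \<circ> B \<in> gl_H J"
  by (simp add: gl_H_iff linear_compose)

text \<open>Averaging over the group of quaternion units; opposite units contribute equally, so the
  four units \<open>1, J\<^sub>1, J\<^sub>2, J\<^sub>3\<close> suffice.\<close>

definition quaternionic_average :: "('a \<Rightarrow> 'a) \<Rightarrow> 'a \<Rightarrow> 'a" where
  "quaternionic_average F X =
     (1/4) *\<^sub>R (F X - J 1 (F (J 1 X)) - J 2 (F (J 2 X)) - J 3 (F (J 3 X)))"

lemma quaternionic_average_in_gl_H:
  assumes F: "linear F"
  shows "quaternionic_average F \<in> gl_H J"
proof -
  note F_simps = linear_add[OF F] linear_neg[OF F] linear_scale[OF F]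
  have "linear (quaternionic_average F)"
    by (rule linearI)
      (simp_all add: quaternionic_average_def J_linear_simps F_simps algebra_simps)
  moreover have "quaternionic_average F (J a X) = J a (quaternionic_average F X)"
    if "a \<in> {1,2,3}" for a X
    using that
    by (auto simp: quaternionic_average_def J_linear_simps F_simps quaternion_relations
        algebra_simps)
  ultimately show ?thesis by (simp add: gl_H_iff)
qed

text \<open>A real linear right inverse of \<open>A\<close> on its range stays one when it is averaged, because
  \<open>A\<close> and its range are invariant under the quaternion units.\<close>

lemma gl_H_generalized_inverse:
  assumes A: "A \<in> gl_H J"
  obtains Q where "Q \<in> gl_H J" "\<And>X. A (Q (A X)) = A X"
proof -
  have lin: "linear A" and comm: "\<And>a X. a \<in> {1,2,3} \<Longrightarrow> A (J a X) = J a (A X)"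
    using A by (auto simp: gl_H_iff)
  obtain F where F: "linear F" "\<And>V. V \<in> range A \<Longrightarrow> A (F V) = V"
    using linear_exists_right_inverse_on[OF lin subspace_UNIV] by auto
  have inv: "A (F (A X)) = A X" for X
    by (simp add: F(2))
  have inv_J: "A (F (J a (A X))) = J a (A X)" if "a \<in> {1,2,3}" for a X
    using inv[of "J a X"] comm[OF that] by simp
  have "A (quaternionic_average F (A X)) = A X" for X
  proof -
    have "A (quaternionic_average F (A X)) = (1/4) *\<^sub>R (A X + A X + A X + A X)"
      by (simp add: quaternionic_average_def linear_scale[OF lin] linear_diff[OF lin]
          comm inv inv_J quaternion_relations)
    also have "\<dots> = A X"
      by (simp add: scaleR_add_right flip: scaleR_add_left)
    finally show ?thesis .
  qed
  then show ?thesis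
    using that quaternionic_average_in_gl_H[OF F(1)] by blast
qed

text \<open>With \<open>Q\<close> as above, \<open>[A Q, A] = A Q A - A\<^sup>2 Q = A\<close>.\<close>

lemma square_zero_in_sl_H:
  assumes A: "A \<in> gl_H J" and sq: "\<And>X. A (A X) = 0"
  shows "A \<in> sl_H J"
proof -
  obtain Q where Q: "Q \<in> gl_H J" "\<And>X. A (Q (A X)) = A X"
    using gl_H_generalized_inverse[OF A] by blast
  have "A = commutator (A \<circ> Q) A"
    by (simp add: commutator_def fun_eq_iff Q(2) sq)
  then have "A \<in> {commutator B C | B C. B \<in> gl_H J \<and> C \<in> gl_H J}"
    using comp_in_gl_H[OF A Q(1)] A by blast
  then show ?thesis
    unfolding sl_H_def by (rule hull_inc)
qed


section \<open>The Obata connection\<close>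

lemma obata_linear_right: "linear (obata br J X)"
  by (rule linearI) (simp_all add: obata_def J_linear_simps br_linear_simps algebra_simps)

lemma obata_torsion_free: "obata br J X Y - obata br J Y X = br X Y"
proof -
  have i1: "br X Y + J 1 (br (J 1 X) Y + br X (J 1 Y)) - br (J 1 X) (J 1 Y) = 0"
    and i2: "br X Y + J 2 (br (J 2 X) Y + br X (J 2 Y)) - br (J 2 X) (J 2 Y) = 0"
    by (simp_all add: integrable)
  \<comment> \<open>The two mixed terms come from \<open>J\<^sub>3\<close>-integrability, as \<open>J\<^sub>3 J\<^sub>1 = J\<^sub>2\<close>.\<close>
  have i3: "br (J 1 X) (J 1 Y) + J 3 (br (J 2 X) (J 1 Y) + br (J 1 X) (J 2 Y))
      - br (J 2 X) (J 2 Y) = 0"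
    using integrable[of 3 "J 1 X" "J 1 Y"] by (simp add: quaternion_relations)
  have combine: "P - Q + R = 0" if "A + P - B = 0" "A + Q - C = 0" "B + R - C = 0"
    for A B C P Q R :: 'a
  proof -
    have "P - Q + R = (A + P - B) - (A + Q - C) + (B + R - C)" by simp
    then show ?thesis by (simp only: that) simp
  qed
  have "obata br J X Y - obata br J Y X = (1/2) *\<^sub>R
      (br X Y + br X Y + (J 1 (br (J 1 X) Y + br X (J 1 Y))
       - J 2 (br (J 2 X) Y + br X (J 2 Y)) + J 3 (br (J 2 X) (J 1 Y) + br (J 1 X) (J 2 Y))))"
    by (simp add: obata_def J_linear_simps br_skew[of Y] br_skew[of "J 1 Y"]
        flip: scaleR_diff_right)
  also have "J 1 (br (J 1 X) Y + br X (J 1 Y)) - J 2 (br (J 2 X) Y + br X (J 2 Y))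
       + J 3 (br (J 2 X) (J 1 Y) + br (J 1 X) (J 2 Y)) = 0"
    by (rule combine[OF i1 i2 i3])
  finally show ?thesis
    by (simp flip: scaleR_2)
qed

text \<open>The formula visibly commutes with \<open>J\<^sub>2\<close>, and \<open>J\<^sub>3 = J\<^sub>1 J\<^sub>2\<close>. For \<open>J\<^sub>1\<close>, the terms without
  \<open>J\<^sub>2 Y\<close> are handled by integrability of \<open>J\<^sub>1\<close> at \<open>(X, Y)\<close>, and those with it by integrability of
  \<open>J\<^sub>1\<close> at \<open>(X, J\<^sub>2 Y)\<close>.\<close>

lemma obata_J:
  assumes "a \<in> {1,2,3}"
  shows "obata br J X (J a Y) = J a (obata br J X Y)"
proof -
  have c2: "obata br J X (J 2 Y) = J 2 (obata br J X Y)" for Y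
    by (simp add: obata_def J_linear_simps br_linear_simps quaternion_relations)
  have c1: "obata br J X (J 1 Y) = J 1 (obata br J X Y)" for Y
  proof -
    have "J 1 (br X Y + J 1 (br (J 1 X) Y + br X (J 1 Y)) - br (J 1 X) (J 1 Y)) = 0"
      by (subst integrable) (simp_all add: J_linear_simps)
    then have i1: "J 1 (br X Y) - br (J 1 X) Y - br X (J 1 Y) - J 1 (br (J 1 X) (J 1 Y)) = 0"
      by (simp add: J_linear_simps quaternion_relations algebra_simps)
    have "J 3 (br X (J 2 Y) + J 1 (br (J 1 X) (J 2 Y) + br X (J 3 Y))
        - br (J 1 X) (J 3 Y)) = 0"
      using integrable[of 1 X "J 2 Y"] by (simp add: J_linear_simps quaternion_relations)
    then have i2: "J 3 (br X (J 2 Y)) + J 2 (br (J 1 X) (J 2 Y)) + J 2 (br X (J 3 Y))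
        - J 3 (br (J 1 X) (J 3 Y)) = 0"
      by (simp add: J_linear_simps quaternion_relations algebra_simps)
    have "J 1 (obata br J X Y) - obata br J X (J 1 Y) = (1/2) *\<^sub>R
       ((J 1 (br X Y) - br (J 1 X) Y - br X (J 1 Y) - J 1 (br (J 1 X) (J 1 Y)))
       - (J 3 (br X (J 2 Y)) + J 2 (br (J 1 X) (J 2 Y)) + J 2 (br X (J 3 Y))
        - J 3 (br (J 1 X) (J 3 Y))))"
      by (simp add: obata_def J_linear_simps br_linear_simps quaternion_relations
          flip: scaleR_diff_right)
    then show ?thesis
      by (simp add: i1 i2)
  qed
  have "obata br J X (J 3 Y) = J 3 (obata br J X Y)"
    using c1[of "J 2 Y"] c2[of Y] by (simp add: quaternion_relations)
  with assms c1 c2 show ?thesis by auto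
qed


section \<open>Central images of the commutator ideal\<close>

lemma br_in_commutator_ideal: "br X Y \<in> commutator_ideal br"
  unfolding commutator_ideal_def bracket_span_def by (rule span_base) auto

lemma subspace_commutator_ideal: "subspace (commutator_ideal br)"
  unfolding commutator_ideal_def bracket_span_def by (rule subspace_span)

lemma br_center_left: "Z \<in> center br \<Longrightarrow> br Z X = 0"
  using br_skew[of Z X] by (simp add: center_def)

lemma uminus_in_center: "Z \<in> center br \<Longrightarrow> - Z \<in> center br"
  by (simp add: center_def br_linear_simps)

lemma br_commutes_with_J:
  assumes a: "a \<in> {1,2,3}" and central: "J a V \<in> center br"
  shows "br V (J a Y) = J a (br V Y)"
proof -
  have "br V Y + J a (br V (J a Y)) = 0"
    using integrable[OF a, of V Y] br_center_left[OF central] by simp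
  then have "J a (br V Y + J a (br V (J a Y))) = 0"
    using a by (simp add: J_linear_simps)
  then show ?thesis
    using a by (simp add: J_linear_simps J_square)
qed

text \<open>Two of the three complex structures generate the third.\<close>

lemma br_in_gl_H:
  assumes ab: "a \<in> {1,2,3}" "b \<in> {1,2,3}" "a \<noteq> b"
    and central: "J a V \<in> center br" "J b V \<in> center br"
  shows "br V \<in> gl_H J"
proof -
  have ca: "\<And>Y. br V (J a Y) = J a (br V Y)" and cb: "\<And>Y. br V (J b Y) = J b (br V Y)"
    using br_commutes_with_J ab central by blast+
  have "br V (J 1 Y) = J 1 (br V Y) \<and> br V (J 2 Y) = J 2 (br V Y) \<and> br V (J 3 Y) = J 3 (br V Y)"
    for Y
  proof -
    consider "{a, b} = {1,2}" | "{a, b} = {2,3}" | "{a, b} = {3,1}"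
      using ab by auto
    then show ?thesis
    proof cases
      case 1
      then have c: "\<And>Y. br V (J 1 Y) = J 1 (br V Y)" "\<And>Y. br V (J 2 Y) = J 2 (br V Y)"
        using ca cb by (auto simp: doubleton_eq_iff)
      then show ?thesis using c(1)[of "J 2 Y"] by (simp add: quaternion_relations)
    next
      case 2
      then have c: "\<And>Y. br V (J 2 Y) = J 2 (br V Y)" "\<And>Y. br V (J 3 Y) = J 3 (br V Y)"
        using ca cb by (auto simp: doubleton_eq_iff)
      then show ?thesis using c(1)[of "J 3 Y"] by (simp add: quaternion_relations)
    next
      case 3
      then have c: "\<And>Y. br V (J 3 Y) = J 3 (br V Y)" "\<And>Y. br V (J 1 Y) = J 1 (br V Y)"
        using ca cb by (auto simp: doubleton_eq_iff)
      then show ?thesis using c(1)[of "J 1 Y"] by (simp add: quaternion_relations)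
    qed
  qed
  moreover have "linear (br V)"
    using bilinear_br by (simp add: bilinear_def)
  ultimately show ?thesis by (auto simp: gl_H_iff)
qed

end

locale two_central_images = hypercomplex_lie_algebra br J
  for br :: "'a::real_vector \<Rightarrow> 'a \<Rightarrow> 'a" and J :: "nat \<Rightarrow> 'a \<Rightarrow> 'a" +
  fixes a b :: nat
  assumes indices: "a \<in> {1,2,3}" "b \<in> {1,2,3}" "a \<noteq> b"
    and central_images: "J a ` commutator_ideal br \<subseteq> center br"
      "J b ` commutator_ideal br \<subseteq> center br"
begin

lemma ad_commutator_ideal_in_gl_H: "W \<in> commutator_ideal br \<Longrightarrow> br W \<in> gl_H J"
  using br_in_gl_H[OF indices] central_images by blast

lemma ad_commutator_ideal_J:
  "W \<in> commutator_ideal br \<Longrightarrow> c \<in> {1,2,3} \<Longrightarrow> br W (J c Y) = J c (br W Y)"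
  using ad_commutator_ideal_in_gl_H by (auto simp: gl_H_iff)

text \<open>If \<open>J\<^sub>1 W\<close> is central, both sides vanish. Otherwise \<open>J\<^sub>2 W\<close> and \<open>J\<^sub>3 W\<close> are central; as
  \<open>J\<^sub>2 J\<^sub>1 W = - J\<^sub>3 W\<close>, the operator \<open>ad (J\<^sub>1 W)\<close> still commutes with \<open>J\<^sub>2\<close>.\<close>

lemma br_J1_commutes_with_J2:
  assumes W: "W \<in> commutator_ideal br"
  shows "br (J 1 W) (J 2 Y) = J 2 (br (J 1 W) Y)"
proof (cases "J 1 W \<in> center br")
  case True
  then show ?thesis by (simp add: br_center_left J_linear_simps)
next
  case False
  then have "J 3 W \<in> center br"
    using W indices central_images by blast
  then have "J 2 (J 1 W) \<in> center br"
    by (simp add: quaternion_relations uminus_in_center)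
  then show ?thesis
    by (simp add: br_commutes_with_J)
qed

text \<open>Quaternionic linearity of \<open>ad W\<close> turns the third term of the Obata formula into a second
  copy of \<open>[W, Y]\<close>. As \<open>ad (J\<^sub>1 W)\<close> commutes with \<open>J\<^sub>2\<close> and \<open>J\<^sub>3 J\<^sub>2 = - J\<^sub>1\<close>, the second and
  fourth terms cancel.\<close>

lemma obata_commutator_ideal:
  assumes W: "W \<in> commutator_ideal br"
  shows "obata br J W = br W"
proof
  fix Y
  show "obata br J W Y = br W Y"
    by (simp add: obata_def ad_commutator_ideal_J[OF W] br_J1_commutes_with_J2[OF W]
        quaternion_relations flip: scaleR_2)
qed

lemma obata_kills_commutator_ideal:
  assumes "W \<in> commutator_ideal br"
  shows "obata br J X W = 0"
  using obata_torsion_free[of X W] obata_commutator_ideal[OF assms] br_skew[of X W] by simp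

lemma obata_comp_obata: "obata br J X (obata br J Y Z) = 0"
proof -
  note D = obata_linear_right[of X]
  have "obata br J X (br U V) = 0" for U V
    by (rule obata_kills_commutator_ideal[OF br_in_commutator_ideal])
  then show ?thesis
    by (simp add: obata_def[of br J Y] linear_add[OF D] linear_diff[OF D] linear_scale[OF D]
        obata_J J_linear_simps)
qed

lemma ad_comp_ad:
  "V \<in> commutator_ideal br \<Longrightarrow> W \<in> commutator_ideal br \<Longrightarrow> br V (br W Z) = 0"
  using obata_comp_obata[of V W Z] by (simp add: obata_commutator_ideal)


section \<open>Curvature and nilpotency\<close>

lemma curvature_eq: "curvature br J X Y = (\<lambda>Z. - br (br X Y) Z)"
  by (simp add: curvature_def commutator_def obata_comp_obata
      obata_commutator_ideal[OF br_in_commutator_ideal])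

text \<open>\<open>[X, W]\<close> lies in \<open>J\<^sub>a g\<^sup>1\<close>, because the quaternionic linear \<open>ad W\<close> has a
  \<open>J\<^sub>a\<close>-invariant image inside \<open>g\<^sup>1\<close>.\<close>

lemma br_commutator_ideal_central:
  assumes W: "W \<in> commutator_ideal br"
  shows "br X W \<in> center br"
proof -
  have "br X W = J a (br W (J a X))"
    using indices(1) by (simp add: ad_commutator_ideal_J[OF W] J_square br_skew[of X W])
  then show ?thesis
    using central_images(1) br_in_commutator_ideal by blast
qed

lemma lower_central_2: "lower_central br 2 = bracket_span br UNIV (commutator_ideal br)"
  by (simp add: numeral_2_eq_2 commutator_ideal_def)

lemma bracket_span_eq_0_iff: "bracket_span br A B = {0} \<longleftrightarrow> (\<forall>X\<in>A. \<forall>Y\<in>B. br X Y = 0)"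
proof -
  have "span S = {0} \<longleftrightarrow> (\<forall>V\<in>S. V = 0)" for S :: "'a set"
    using span_superset[of S] span_mono[of S "{0}"] span_zero[of S] by auto
  then show ?thesis
    unfolding bracket_span_def by (simp only:) blast
qed

lemma lower_central_2_eq_0_iff:
  "lower_central br 2 = {0} \<longleftrightarrow> (\<forall>X Y Z. br (br X Y) Z = 0)"
proof -
  have "lower_central br 2 = {0} \<longleftrightarrow> (\<forall>X. \<forall>W\<in>commutator_ideal br. br W X = 0)"
    unfolding lower_central_2 bracket_span_eq_0_iff
    by (metis br_skew neg_equal_0_iff_equal UNIV_I)
  also have "\<dots> \<longleftrightarrow> (\<forall>X Y Z. br (br X Y) Z = 0)"
  proof
    assume *: "\<forall>X Y Z. br (br X Y) Z = 0"
    have "commutator_ideal br \<subseteq> {W. \<forall>X. br W X = 0}"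
      unfolding commutator_ideal_def bracket_span_def
      using * by (intro span_minimal) (auto simp: subspace_def br_linear_simps)
    then show "\<forall>X. \<forall>W\<in>commutator_ideal br. br W X = 0" by blast
  qed (simp add: br_in_commutator_ideal)
  finally show ?thesis .
qed

lemma lower_central_3: "lower_central br 3 = {0}"
proof -
  have "subspace (center br)"
    by (simp add: subspace_def center_def br_linear_simps)
  then have "lower_central br 2 \<subseteq> center br"
    unfolding lower_central_2 bracket_span_def
    using br_commutator_ideal_central by (intro span_minimal) auto
  then have "bracket_span br UNIV (lower_central br 2) = {0}"
    unfolding bracket_span_eq_0_iff by (auto simp: center_def)
  then show ?thesis
    by (simp add: numeral_3_eq_3 numeral_2_eq_2)
qed

lemma lower_central_eq_0_mono:
  assumes "j \<le> k" "lower_central br j = {0}"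
  shows "lower_central br k = {0}"
  using assms by (induction rule: dec_induct) (simp_all add: bracket_span_eq_0_iff br_linear_simps)

lemma nonflat_iff_three_step: "\<not> flat br J \<longleftrightarrow> step_nilpotent br 3"
proof -
  have "lower_central br j \<noteq> {0}" if "lower_central br 2 \<noteq> {0}" "j < 3" for j
    using lower_central_eq_0_mono[of j 2] that by auto
  then have "step_nilpotent br 3 \<longleftrightarrow> lower_central br 2 \<noteq> {0}"
    by (auto simp: step_nilpotent_def lower_central_3)
  then show ?thesis
    by (simp add: flat_def curvature_eq lower_central_2_eq_0_iff)
qed


section \<open>Holonomy\<close>

lemma lie_subalgebra_ad_commutator_ideal: "lie_subalgebra_gl (br ` commutator_ideal br)"
proof -
  note sub = subspace_commutator_ideal
  have "(\<lambda>X. 0) = br 0" "\<And>V W. (\<lambda>X. br V X + br W X) = br (V + W)"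
    "\<And>c V. (\<lambda>X. c *\<^sub>R br V X) = br (c *\<^sub>R V)"
    by (simp_all add: fun_eq_iff br_linear_simps)
  moreover have "linear (br V)" for V
    using bilinear_br by (simp add: bilinear_def)
  ultimately have "endo_subspace (br ` commutator_ideal br)"
    by (auto simp: endo_subspace_def subspace_0[OF sub] subspace_add[OF sub]
        subspace_scale[OF sub])
  moreover have "commutator (br V) (br W) = br 0"
    if "V \<in> commutator_ideal br" "W \<in> commutator_ideal br" for V W
    using that by (simp add: commutator_def ad_comp_ad br_linear_simps fun_eq_iff)
  ultimately show ?thesis
    by (auto simp: lie_subalgebra_gl_def subspace_0[OF sub])
qed

text \<open>For \<open>W \<in> g\<^sup>1\<close> both \<open>D\<^sub>X \<circ> ad W\<close> and \<open>ad W \<circ> D\<^sub>X\<close> are products of two Obata operators, hence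
  zero: bracketing with the connection adds nothing to the span of the curvature operators.\<close>

lemma hol_eq: "hol br J = br ` commutator_ideal br"
  unfolding hol_def
proof (rule hull_unique)
  have "(\<lambda>Z. - br (br X Y) Z) = br (br (- X) Y)" for X Y
    by (simp add: br_linear_simps fun_eq_iff)
  then show "{curvature br J X Y |X Y. True} \<subseteq> br ` commutator_ideal br"
    using br_in_commutator_ideal by (auto simp: curvature_eq)
next
  have "commutator (obata br J X) (br W) = br 0" if W: "W \<in> commutator_ideal br" for X W
    using obata_comp_obata[of X W] obata_comp_obata[of W X] obata_commutator_ideal[OF W]
    by (simp add: commutator_def br_linear_simps fun_eq_iff)
  then show "lie_subalgebra_gl (br ` commutator_ideal br) \<and>
      (\<forall>X. \<forall>A\<in>br ` commutator_ideal br.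
        commutator (obata br J X) A \<in> br ` commutator_ideal br)"
    using lie_subalgebra_ad_commutator_ideal subspace_0[OF subspace_commutator_ideal] by auto
next
  fix T
  assume R: "{curvature br J X Y |X Y. True} \<subseteq> T"
    and T: "lie_subalgebra_gl T \<and> (\<forall>X. \<forall>A\<in>T. commutator (obata br J X) A \<in> T)"
  then have sub: "endo_subspace T" by (simp add: lie_subalgebra_gl_def)
  have "subspace {W. br W \<in> T}"
  proof -
    have "br 0 = (\<lambda>X. 0)" "\<And>V W. br (V + W) = (\<lambda>X. br V X + br W X)"
      "\<And>c V. br (c *\<^sub>R V) = (\<lambda>X. c *\<^sub>R br V X)"
      by (simp_all add: fun_eq_iff br_linear_simps)
    with sub show ?thesis
      by (simp add: subspace_def endo_subspace_def)
  qed
  moreover have "br (br X Y) \<in> T" for X Y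
  proof -
    have "br (br X Y) = curvature br J (- X) Y"
      by (simp add: curvature_eq br_linear_simps)
    with R show ?thesis by auto
  qed
  ultimately have "commutator_ideal br \<subseteq> {W. br W \<in> T}"
    unfolding commutator_ideal_def bracket_span_def by (intro span_minimal) auto
  then show "br ` commutator_ideal br \<subseteq> T" by auto
qed

lemma hol_comp: "A \<in> hol br J \<Longrightarrow> B \<in> hol br J \<Longrightarrow> A \<circ> B = (\<lambda>X. 0)"
  by (auto simp: hol_eq ad_comp_ad fun_eq_iff)

lemma hol_subset_sl_H: "hol br J \<subseteq> sl_H J"
  using square_zero_in_sl_H ad_commutator_ideal_in_gl_H ad_comp_ad by (auto simp: hol_eq)

lemma hol_abelian: "abelian_lie_subalgebra_gl (hol br J)"
  using lie_subalgebra_ad_commutator_ideal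
  by (auto simp: abelian_lie_subalgebra_gl_def hol_eq commutator_def ad_comp_ad)

lemma hol_commutative_subalgebra: "commutative_subalgebra_End (hol br J)"
proof -
  have "endo_subspace (hol br J)"
    using hol_abelian by (simp add: abelian_lie_subalgebra_gl_def lie_subalgebra_gl_def)
  then show ?thesis
    by (simp add: commutative_subalgebra_End_def hol_comp) (simp add: endo_subspace_def)
qed

end

theorem proposition7p2:
  fixes br :: "'a::real_vector \<Rightarrow> 'a \<Rightarrow> 'a"
    and J :: "nat \<Rightarrow> 'a \<Rightarrow> 'a"
    and n \<alpha> \<beta> \<gamma> :: nat
  assumes "hypercomplex_lie_algebra br J"
    and "dim (UNIV :: 'a set) = 4 * n"
    and "(\<alpha>, \<beta>, \<gamma>) \<in> {(1, 2, 3), (2, 3, 1), (3, 1, 2)}"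
    and "J \<alpha> ` commutator_ideal br \<subseteq> center br"
    and "J \<beta> ` commutator_ideal br \<subseteq> center br"
  shows "((\<forall>X Y. curvature br J X Y = (\<lambda>Z. - ad br (br X Y) Z)) \<and>
          (\<not> flat br J \<longleftrightarrow> step_nilpotent br 3)) \<and>
         (abelian_lie_subalgebra_gl (hol br J) \<and> hol br J \<subseteq> sl_H J \<and>
          (\<forall>A\<in>hol br J. \<forall>B\<in>hol br J. A \<circ> B = (\<lambda>X. 0)) \<and>
          commutative_subalgebra_End (hol br J))"
proof -
  interpret hypercomplex_lie_algebra br J by (rule assms(1))
  interpret two_central_images br J \<alpha> \<beta>
    using assms(3-5) by unfold_locales auto
  show ?thesis
    by (simp add: curvature_eq ad_def nonflat_iff_three_step hol_abelian hol_subset_sl_H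
        hol_comp hol_commutative_subalgebra)
qed

end
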